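(* Let $r\in[0,\infty)$. The space $\Omega_{\mathrm{sub}}^r$ is the weak*-closed convex hull $\overline{\mathrm{conv}}\{m_r\circ R_s:0\le s<1\}$. If $r=0$, then $m_r=\mu$ and $\Omega_{\mathrm{sub}}^r=\{\mu\}$, where $\mu$ is Lebesgue measure on $\mathbb{S}$.
   Context: $\mathbb{S}:=\mathbb{R}/\mathbb{Z}$, identified with $[0,1)$ under addition modulo 1. For $t\in\mathbb{R}$, $R_t:\mathbb{S}\to\mathbb{S}$ is $R_t(x)=x-t\pmod 1$. $M(\mathbb{S})$ is the set of Borel probability measures on $\mathbb{S}$, with the weak* topology, and \[ \Omega_{\mathrm{sub}}^{r}:=\{m\in M(\mathbb{S}):m(R_t(U))\le e^{rt}m(U)\text{ for all }t\in[0,\infty)\text{ and Borel }U\subseteq\mathbb{S}\}. \] $m_r$ is the Borel probability measure $m_r(U)=\int_U W_r(t)\,dt$, where $W_r(t)=\frac{r}{1-e^{-r}}e^{-rt}$ for $t\in[0,1)$, with the convention $W_0\equiv 1$ (the limit as $r\to0$). $(m\circ R_s)(U):=m(R_s(U))$. *)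

theory Defs
  imports "HOL-Probability.Probability"
begin

quotient_type circle = real / "\<lambda>x y :: real. x - y \<in> \<int>"
  morphisms rep_circle to_circle
proof (rule equivpI)
  show "reflp (\<lambda>x y :: real. x - y \<in> \<int>)" by (simp add: reflp_def)
  show "symp (\<lambda>x y :: real. x - y \<in> \<int>)"
    by (metis (no_types, lifting) Ints_minus minus_diff_eq sympI)
  show "transp (\<lambda>x y :: real. x - y \<in> \<int>)"
  proof (rule transpI)
    fix x y z :: real assume "x - y \<in> \<int>" "y - z \<in> \<int>"
    then have "(x - y) + (y - z) \<in> \<int>" by (rule Ints_add)
    then show "x - z \<in> \<int>" by simp
  qed
qed

text \<open>The quotient topology of \<open>\<real>/\<int>\<close>; points near \<open>1\<close> in \<open>[0,1)\<close> are thus close to \<open>0\<close>.\<close>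

instantiation circle :: topological_space
begin

definition open_circle :: "circle set \<Rightarrow> bool" where
  "open_circle U \<longleftrightarrow> open (to_circle -` U)"

instance
  by standard (auto simp: open_circle_def vimage_Union intro: open_Int)

end

lemma continuous_on_to_circle: "continuous_on UNIV to_circle"
  by (simp add: continuous_on_open_vimage open_circle_def)

lemma measurable_to_circle [measurable]: "to_circle \<in> borel_measurable borel"
  by (rule borel_measurable_continuous_onI[OF continuous_on_to_circle])

text \<open>The fundamental domain identification of the circle with \<open>[0,1)\<close>.\<close>

lemma bij_betw_to_circle: "bij_betw to_circle {0..<1} UNIV"
proof (rule bij_betwI')
  fix x y :: real assume "x \<in> {0..<1}" "y \<in> {0..<1}"
  then have "x - y \<in> \<int> \<longleftrightarrow> x = y"
    using Ints_nonzero_abs_ge1[of "x - y"] by (cases "x = y") auto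
  then show "to_circle x = to_circle y \<longleftrightarrow> x = y"
    by (simp add: circle.abs_eq_iff)
next
  fix c :: circle
  have "rep_circle c - frac (rep_circle c) \<in> \<int>"
    by (simp add: frac_def)
  then have "c = to_circle (frac (rep_circle c))"
    by (metis Quotient3_circle Quotient3_abs_rep circle.abs_eq_iff)
  moreover have "frac (rep_circle c) \<in> {0..<1}"
    by (simp add: frac_lt_1)
  ultimately show "\<exists>x\<in>{0..<1}. c = to_circle x" by blast
qed auto

lift_definition rot :: "real \<Rightarrow> circle \<Rightarrow> circle" is "\<lambda>t x. x - t"
  by simp

lemma rot_rot_uminus [simp]: "rot t (rot (- t) x) = x" "rot (- t) (rot t x) = x"
  by (transfer, simp)+

lemma rot_image_eq_vimage: "rot t ` U = rot (- t) -` U"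
  by (auto simp: image_iff intro: rev_bexI) (metis rot_rot_uminus(1))

lemma continuous_on_rot: "continuous_on UNIV (rot t)"
proof -
  have "open (to_circle -` rot t -` B)" if "open B" for B
  proof -
    have "to_circle -` rot t -` B = (\<lambda>x. x - t) -` to_circle -` B"
      by (simp add: vimage_def rot.abs_eq)
    also have "open \<dots>"
    proof (rule open_vimage)
      show "open (to_circle -` B)" using that by (simp add: open_circle_def)
    qed (intro continuous_intros)
    finally show ?thesis .
  qed
  then show ?thesis
    by (simp add: continuous_on_open_vimage open_circle_def)
qed

lemma measurable_rot [measurable]: "rot t \<in> borel_measurable borel"
  by (rule borel_measurable_continuous_onI[OF continuous_on_rot])

definition prob_measures :: "circle measure set" where
  "prob_measures = {m. sets m = sets borel \<and> prob_space m}"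

definition weakstar :: "circle measure topology" where
  "weakstar = topology_generated_by
     {{m \<in> prob_measures. (\<integral>x. f x \<partial>m) \<in> V} | (f :: circle \<Rightarrow> real) V.
        continuous_on UNIV f \<and> open V}"

lemma topspace_weakstar: "topspace weakstar = prob_measures"
proof -
  have "prob_measures \<in> {{m \<in> prob_measures. (\<integral>x. f x \<partial>m) \<in> V} | (f :: circle \<Rightarrow> real) V.
      continuous_on UNIV f \<and> open V}"
    by (rule CollectI, rule exI[of _ "\<lambda>_. 0"], rule exI[of _ UNIV]) auto
  then show ?thesis
    unfolding weakstar_def topology_generated_by_topspace by blast
qed

text \<open>The type of measures is not a real vector space, so the set of (finite) convex
  combinations is described through its values on Borel sets.\<close>

definition measure_convex_hull :: "circle measure set \<Rightarrow> circle measure set" where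
  "measure_convex_hull K = {m \<in> prob_measures. \<exists>F c. finite F \<and> F \<subseteq> K \<and>
     (\<forall>k\<in>F. 0 \<le> c k) \<and> (\<Sum>k\<in>F. c k) = 1 \<and>
     (\<forall>U\<in>sets borel. measure m U = (\<Sum>k\<in>F. c k * measure k U))}"

definition closed_convex_hull :: "circle measure set \<Rightarrow> circle measure set" where
  "closed_convex_hull K = weakstar closure_of measure_convex_hull K"

definition Omega_sub :: "real \<Rightarrow> circle measure set" where
  "Omega_sub r = {m \<in> prob_measures.
     \<forall>t\<ge>0. \<forall>U\<in>sets borel. measure m (rot t ` U) \<le> exp (r * t) * measure m U}"

definition lebesgue_circle :: "circle measure" where
  "lebesgue_circle = distr (restrict_space lborel {0..<1}) borel to_circle"

definition W_density :: "real \<Rightarrow> real \<Rightarrow> real" where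
  "W_density r t = (if r = 0 then 1 else r / (1 - exp (- r)) * exp (- r * t))"

definition exp_measure :: "real \<Rightarrow> circle measure" where
  "exp_measure r =
     distr (density (restrict_space lborel {0..<1}) (\<lambda>t. ennreal (W_density r t))) borel to_circle"

lemma emeasure_exp_measure:
  assumes "U \<in> sets borel"
  shows "emeasure (exp_measure r) U =
    (\<integral>\<^sup>+t\<in>{0..<1} \<inter> to_circle -` U. ennreal (W_density r t) \<partial>lborel)"
proof -
  have [measurable]: "W_density r \<in> borel_measurable borel"
    unfolding W_density_def by measurable
  have [measurable]: "to_circle -` U \<in> sets borel"
    using measurable_sets_borel[OF measurable_to_circle assms] .
  have "emeasure (exp_measure r) U =
      emeasure (density (restrict_space lborel {0..<1}) (\<lambda>t. ennreal (W_density r t)))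
        ({0..<1} \<inter> to_circle -` U)"
    unfolding exp_measure_def using assms
    by (subst emeasure_distr) (auto simp: space_restrict_space Int_commute measurable_restrict_space1)
  also have "\<dots> = (\<integral>\<^sup>+t\<in>{0..<1} \<inter> to_circle -` U. ennreal (W_density r t) \<partial>restrict_space lborel {0..<1})"
    by (subst emeasure_density) (auto simp: sets_restrict_space intro: measurable_restrict_space1)
  also have "\<dots> = (\<integral>\<^sup>+t\<in>{0..<1} \<inter> to_circle -` U. ennreal (W_density r t) \<partial>lborel)"
    by (subst nn_integral_restrict_space) (auto intro!: nn_integral_cong split: split_indicator)
  finally show ?thesis .
qed

definition comp_rot :: "circle measure \<Rightarrow> real \<Rightarrow> circle measure" where
  "comp_rot m s = measure_of UNIV (sets borel) (\<lambda>U. emeasure m (rot s ` U))"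

lemma comp_rot_eq_distr:
  assumes "sets m = sets borel"
  shows "comp_rot m s = distr m borel (rot (- s))"
proof -
  have "space m = UNIV" using sets_eq_imp_space_eq[OF assms] by simp
  then show ?thesis by (simp add: comp_rot_def distr_def rot_image_eq_vimage)
qed

lemma emeasure_comp_rot:
  assumes "sets m = sets borel" "U \<in> sets borel"
  shows "emeasure (comp_rot m s) U = emeasure m (rot s ` U)"
proof -
  have "space m = UNIV" using sets_eq_imp_space_eq[OF assms(1)] by simp
  moreover have "rot (- s) \<in> measurable m borel"
    using measurable_rot measurable_cong_sets[OF assms(1) refl] by blast
  ultimately show ?thesis
    using assms by (simp add: comp_rot_eq_distr emeasure_distr rot_image_eq_vimage)
qed

end

(*
  Fix N and cut the circle into the arcs I_k = [k/N, (k+1)/N). For r > 0 put q = e^(r/N). If m lies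
  in Omega_sub r, the weights c_k = (q m(I_k) - m(I_(k-1))) / (q - 1) are nonnegative and sum to 1.
  The density of m_r decays by the factor 1/q from each arc to the next, except at its jump at 0, so
  q m_r(I_i) - m_r(I_(i-1)) is q - 1 for i = 0 and vanishes otherwise modulo N. Hence the measure
  sum_k c_k m_r o R_(k/N) satisfies the same cyclic recurrence on the arcs as m, and has the same
  masses on them. By uniform continuity these finite mixtures converge to m in the weak* topology.
  For r = 0 all arcs have equal mass, which leaves only Lebesgue measure.

  Conversely m_r is in Omega_sub r because W_r(x - t) <= e^(rt) W_r(x) for the periodic extension of
  W_r, and Omega_sub r is convex. It is weak*-closed since its defining inequality on Borel sets is
  equivalent to the one for integrals of nonnegative continuous functions, by outer regularity.
*)
theory Submission
  imports Defs
begin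

section \<open>Topology and Borel sets of the circle, and its embedding in the plane\<close>

lemma to_circle_eq_iff: "to_circle x = to_circle y \<longleftrightarrow> x - y \<in> \<int>"
  by (simp add: circle.abs_eq_iff)

lemma to_circle_add_int: "to_circle (x + of_int k) = to_circle x"
  by (simp add: to_circle_eq_iff)

lemma surj_to_circle: "surj to_circle"
  using bij_betw_to_circle by (force simp: bij_betw_def)

lemma rot_to_circle [simp]: "rot t (to_circle x) = to_circle (x - t)"
  by (simp add: rot.abs_eq)

lemma rot_cong: "s - t \<in> \<int> \<Longrightarrow> rot s = rot t"
proof
  fix x assume st: "s - t \<in> \<int>"
  obtain y where "x = to_circle y" using surj_to_circle by blast
  moreover have "(y - s) - (y - t) \<in> \<int>"
    using Ints_minus[OF st] by simp
  ultimately show "rot s x = rot t x" by (simp add: to_circle_eq_iff)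
qed

lemma borel_rot_image: "U \<in> sets borel \<Longrightarrow> rot t ` U \<in> sets borel"
  by (metis measurable_rot measurable_sets_borel rot_image_eq_vimage)

lemma continuous_on_circleI:
  assumes "continuous_on UNIV (\<lambda>x. f (to_circle x))"
  shows "continuous_on UNIV f"
  using assms by (simp add: continuous_on_open_vimage open_circle_def vimage_def)

lemma closed_circle_iff: "closed C \<longleftrightarrow> closed (to_circle -` C)"
  by (simp add: closed_def open_circle_def vimage_Compl)

text \<open>The saturation of \<open>S\<close> under integer translation is the union of the
  translates of \<open>S\<close>, each of them open.\<close>

lemma open_to_circle_image: "open S \<Longrightarrow> open (to_circle ` S)"
proof -
  assume S: "open S"
  have "to_circle -` to_circle ` S = (\<Union>k::int. (\<lambda>x. x + of_int k) -` S)"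
  proof (intro set_eqI iffI)
    fix x assume "x \<in> to_circle -` to_circle ` S"
    then obtain y where y: "y \<in> S" "x - y \<in> \<int>" by (auto simp: to_circle_eq_iff)
    then obtain k where "x - y = of_int k" by (auto elim: Ints_cases)
    then have "y = x + of_int (- k)" by simp
    with y(1) show "x \<in> (\<Union>k::int. (\<lambda>x. x + of_int k) -` S)" by blast
  next
    fix x assume "x \<in> (\<Union>k::int. (\<lambda>x. x + of_int k) -` S)"
    then obtain k :: int where "x + of_int k \<in> S" by blast
    then show "x \<in> to_circle -` to_circle ` S"
      using to_circle_add_int[of x k] by (metis imageI vimageI)
  qed
  also have "open \<dots>"
    by (intro open_UN ballI open_vimage S continuous_intros)
  finally show ?thesis by (simp add: open_circle_def)
qed

lemma closed_circle_singleton: "closed {c :: circle}"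
proof -
  obtain a where a: "c = to_circle a" using surj_to_circle by blast
  have "to_circle -` {c} = (\<lambda>x. x - a) -` \<int>"
    by (auto simp: a to_circle_eq_iff)
  also have "closed \<dots>"
    by (intro closed_vimage closed_Ints continuous_intros)
  finally show ?thesis by (simp add: closed_circle_iff)
qed

text \<open>The interval splits into its left endpoint and an open interval; the first has a closed
  image, the second an open one since \<open>to_circle\<close> is an open map.\<close>

lemma borel_to_circle_atLeastLessThan: "to_circle ` {a..<b} \<in> sets borel"
proof (cases "a < b")
  case True
  then have "{a..<b} = insert a {a<..<b}" by auto
  then have "to_circle ` {a..<b} = {to_circle a} \<union> to_circle ` {a<..<b}"
    by (metis image_insert insert_is_Un)
  then show ?thesis
    by (metis borel_closed borel_open closed_circle_singleton open_greaterThanLessThan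
        open_to_circle_image sets.Un)
qed simp

lemma compact_UNIV_circle: "compact (UNIV :: circle set)"
proof -
  have "to_circle ` {0..1} = UNIV"
    using bij_betw_to_circle unfolding bij_betw_def
    by (metis atLeastLessThan_subseteq_atLeastAtMost_iff image_mono order_refl top.extremum_uniqueI)
  then show ?thesis
    by (metis compact_Icc compact_continuous_image continuous_on_subset continuous_on_to_circle
        subset_UNIV)
qed

text \<open>The embedding of the circle in the complex plane makes available the outer regularity
  theorem, which the library has only for complete metric spaces.\<close>

lift_definition circle_cis :: "circle \<Rightarrow> complex" is "\<lambda>x. cis (2 * pi * x)"
proof -
  fix x y :: real assume "x - y \<in> \<int>"
  then obtain k where "x - y = of_int k" by (auto elim: Ints_cases)
  then have "2 * pi * x = 2 * pi * y + 2 * pi * of_int k" by (simp add: algebra_simps)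
  then show "cis (2 * pi * x) = cis (2 * pi * y)"
    by (simp add: cis_mult[symmetric])
qed

lemma circle_cis_to_circle: "circle_cis (to_circle x) = cis (2 * pi * x)"
  by (simp add: circle_cis.abs_eq)

lemma inj_circle_cis: "inj circle_cis"
proof (rule injI)
  fix c d assume eq: "circle_cis c = circle_cis d"
  obtain x y where xy: "c = to_circle x" "d = to_circle y" using surj_to_circle by blast
  from eq have "sin (2 * pi * x) = sin (2 * pi * y) \<and> cos (2 * pi * x) = cos (2 * pi * y)"
    by (simp add: xy circle_cis_to_circle complex_eq_iff)
  then obtain n :: int where "2 * pi * x = 2 * pi * y + 2 * pi * of_int n"
    using sin_cos_eq_iff[of "2 * pi * x" "2 * pi * y"] by auto
  then have "2 * pi * (x - y) = 2 * pi * of_int n" by (simp add: algebra_simps)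
  then have "x - y = of_int n" by simp
  then show "c = d" by (simp add: xy to_circle_eq_iff)
qed

lemma continuous_on_circle_cis: "continuous_on UNIV circle_cis"
  by (rule continuous_on_circleI) (auto simp: circle_cis_to_circle intro!: continuous_intros)

lemma measurable_circle_cis [measurable]: "circle_cis \<in> borel_measurable borel"
  by (rule borel_measurable_continuous_onI[OF continuous_on_circle_cis])

lemma compact_circle_cis_image:
  assumes "closed C"
  shows "compact (circle_cis ` C)"
proof -
  have "compact C"
    using compact_Int_closed[OF compact_UNIV_circle assms] by simp
  then show ?thesis
    by (metis compact_continuous_image continuous_on_circle_cis continuous_on_subset subset_UNIV)
qed

text \<open>Preimages of Borel sets under the embedding form a sigma-algebra, so only open sets
  \<open>S\<close> have to be checked; there the image of the complement is compact, hence closed in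
  the plane. This carries Borel sets of the circle into a metric space, where outer regularity
  applies.\<close>

lemma borel_circle_eq_vimage:
  assumes "U \<in> sets borel"
  shows "\<exists>B\<in>sets borel. U = circle_cis -` B"
proof -
  let ?A = "vimage_algebra UNIV circle_cis borel"
  have "sets (borel :: circle measure) = sigma_sets UNIV {S. open S}"
    by (simp add: borel_def)
  also have "\<dots> \<subseteq> sets ?A"
  proof (rule sets.sigma_sets_subset'[where M = ?A, simplified])
    show "{S :: circle set. open S} \<subseteq> sets ?A"
    proof clarify
      fix S :: "circle set" assume "open S"
      then have "circle_cis ` (- S) \<in> sets borel"
        by (intro borel_compact compact_circle_cis_image) auto
      then have "- (circle_cis ` (- S)) \<in> sets borel" by (auto intro: borel_comp)
      moreover have "S = circle_cis -` (- (circle_cis ` (- S)))"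
        using inj_circle_cis by (auto simp: inj_def)
      ultimately show "S \<in> sets ?A" by (auto simp: sets_vimage_algebra)
    qed
    show "UNIV \<in> sets ?A" using sets.top[of ?A] by simp
  qed
  also have "sets ?A = {circle_cis -` B | B. B \<in> sets borel}"
    by (subst sets_vimage_algebra2) auto
  finally show ?thesis using assms by auto
qed

section \<open>Comparison of measures through integrals of continuous functions\<close>

lemma prob_measures_facts:
  assumes "m \<in> prob_measures"
  shows "sets m = sets borel" "space m = UNIV" "prob_space m"
  using assms sets_eq_imp_space_eq[of m borel] by (auto simp: prob_measures_def)

lemma continuous_integrable:
  fixes f :: "circle \<Rightarrow> real"
  assumes "m \<in> prob_measures" "continuous_on UNIV f"
  shows "integrable m f"
proof -
  interpret prob_space m using assms(1) by (simp add: prob_measures_def)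
  have "compact (range f)"
    using compact_continuous_image[OF assms(2) compact_UNIV_circle] .
  then have "bounded (range f)" by (rule compact_imp_bounded)
  then obtain B where "\<And>x. norm (f x) \<le> B"
    unfolding bounded_iff by blast
  moreover have "f \<in> borel_measurable m"
    using borel_measurable_continuous_onI[OF assms(2)] prob_measures_facts(1)[OF assms(1)]
      measurable_cong_sets by blast
  ultimately show ?thesis by (intro integrable_const_bound[of _ B]) auto
qed

text \<open>The indicator of an open set is the pointwise limit of continuous functions with values
  in \<open>[0, 1]\<close>, built from the distance to the complement in the plane; dominated
  convergence passes the integral inequality to \<open>U\<close>.\<close>

lemma measure_le_if_integral_le_open:
  assumes M: "M \<in> prob_measures" and M': "M' \<in> prob_measures"
    and le: "\<And>f :: circle \<Rightarrow> real. continuous_on UNIV f \<Longrightarrow> (\<And>x. 0 \<le> f x) \<Longrightarrow>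
      (\<integral>x. f x \<partial>M) \<le> c * (\<integral>x. f x \<partial>M')"
    and U: "open U"
  shows "measure M U \<le> c * measure M' U"
\<comment> \<open>For \<open>U = UNIV\<close> the set \<open>C\<close> below is empty and
  \<open>infdist\<close> to it is 0 by convention, so the functions \<open>f n\<close> would
  vanish.\<close>
proof (cases "U = UNIV")
  case True
  then show ?thesis
    using le[of "\<lambda>_. 1"] prob_measures_facts[OF M] prob_measures_facts[OF M']
    by (simp add: prob_space.prob_space)
next
  case False
  define C where "C = circle_cis ` (- U)"
  define f where "f n x = min 1 (real n * infdist (circle_cis x) C)" for n x
  have C: "closed C" "C \<noteq> {}"
    using False U compact_circle_cis_image[of "- U"] compact_imp_closed
    by (auto simp: C_def closed_def)
  have f_cont: "continuous_on UNIV (f n)" for n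
    unfolding f_def by (intro continuous_intros continuous_on_circle_cis)
  have f_nonneg: "0 \<le> f n x" for n x by (simp add: f_def infdist_nonneg)
  have lim: "(\<lambda>n. f n x) \<longlonglongrightarrow> indicator U x" for x
  proof (cases "x \<in> U")
    case True
    then have "circle_cis x \<notin> C" using inj_circle_cis by (auto simp: C_def inj_def)
    then have pos: "0 < infdist (circle_cis x) C"
      by (metis C in_closed_iff_infdist_zero infdist_nonneg order_le_less)
    then obtain k :: nat where k: "1 < real k * infdist (circle_cis x) C"
      using ex_less_of_nat_mult by blast
    have "f n x = 1" if "n \<ge> k" for n
    proof -
      have "real k * infdist (circle_cis x) C \<le> real n * infdist (circle_cis x) C"
        using that pos by (intro mult_right_mono) auto
      with k show ?thesis by (simp add: f_def)
    qed
    then have "(\<lambda>n. f n x) \<longlonglongrightarrow> 1"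
      by (intro tendsto_eventually) (auto simp: eventually_sequentially)
    with True show ?thesis by simp
  next
    case False
    then have "infdist (circle_cis x) C = 0" by (simp add: C_def)
    with False show ?thesis by (simp add: f_def)
  qed
  have conv: "(\<lambda>n. \<integral>x. f n x \<partial>m) \<longlonglongrightarrow> measure m U" if m: "m \<in> prob_measures" for m
  proof -
    interpret prob_space m using m by (simp add: prob_measures_def)
    have s: "sets m = sets borel" "space m = UNIV" using prob_measures_facts[OF m] by auto
    have "(\<lambda>n. \<integral>x. f n x \<partial>m) \<longlonglongrightarrow> (\<integral>x. indicator U x \<partial>m)"
    proof (rule integral_dominated_convergence[where w = "\<lambda>_. 1"])
      show "f n \<in> borel_measurable m" for n
        using borel_measurable_continuous_onI[OF f_cont] s(1) measurable_cong_sets by blast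
      show "indicator U \<in> borel_measurable m"
        using U s(1) by (intro borel_measurable_indicator) simp
      show "AE x in m. norm (f n x) \<le> 1" for n using f_nonneg by (auto simp: f_def)
    qed (use lim in auto)
    then show ?thesis by (simp add: s)
  qed
  show ?thesis
    by (rule LIMSEQ_le[OF conv[OF M] tendsto_mult_left[OF conv[OF M']]])
      (use le[OF f_cont f_nonneg] in auto)
qed

text \<open>Outer regularity of \<open>M'\<close> encloses \<open>U\<close> in an open set whose
  \<open>M'\<close>-mass is larger by less than \<open>e\<close>; monotonicity of \<open>M\<close>
  and the open case give the bound up to \<open>c * e\<close>.\<close>

lemma measure_le_if_integral_le:
  assumes M: "M \<in> prob_measures" and M': "M' \<in> prob_measures" and c: "0 \<le> c"
    and le: "\<And>f :: circle \<Rightarrow> real. continuous_on UNIV f \<Longrightarrow> (\<And>x. 0 \<le> f x) \<Longrightarrow>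
      (\<integral>x. f x \<partial>M) \<le> c * (\<integral>x. f x \<partial>M')"
    and U: "U \<in> sets borel"
  shows "measure M U \<le> c * measure M' U"
proof -
  note s = prob_measures_facts(1,2)[OF M] prob_measures_facts(1,2)[OF M']
  interpret M: prob_space M using M by (simp add: prob_measures_def)
  interpret M': prob_space M' using M' by (simp add: prob_measures_def)
  obtain B where B: "B \<in> sets borel" "U = circle_cis -` B"
    using borel_circle_eq_vimage[OF U] by blast
  \<comment> \<open>The image of \<open>M'\<close> in the plane is a finite Borel measure on a
    complete separable metric space, the setting of \<open>outer_regular\<close>.\<close>
  define D where "D = distr M' borel circle_cis"
  have meas: "circle_cis \<in> measurable M' borel"
    using measurable_circle_cis s(3) measurable_cong_sets by blast
  interpret D: prob_space D
    unfolding D_def by (rule M'.prob_space_distr[OF meas])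
  have D_eq: "measure D A = measure M' (circle_cis -` A)" if "A \<in> sets borel" for A
    using that meas by (simp add: D_def measure_distr s)
  have "measure M U \<le> c * (measure M' U + e)" if "e > 0" for e
  proof -
    have "(INF V\<in>{V. B \<subseteq> V \<and> open V}. emeasure D V) = emeasure D B"
      using B(1) D.emeasure_space_1 by (intro outer_regular[symmetric]) (auto simp: D_def)
    also have "\<dots> < ennreal (measure D B + e)"
      using that by (simp add: D.emeasure_eq_measure ennreal_less_iff)
    finally obtain V where V: "B \<subseteq> V" "open V" "emeasure D V < ennreal (measure D B + e)"
      by (auto simp: Inf_less_iff)
    have "measure M U \<le> measure M (circle_cis -` V)"
      using V B s measurable_sets_borel[OF measurable_circle_cis, of V]
      by (intro M.finite_measure_mono) auto
    also have "\<dots> \<le> c * measure M' (circle_cis -` V)"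
      using V(2) continuous_on_circle_cis
      by (intro measure_le_if_integral_le_open[OF M M' le]) (auto simp: continuous_on_open_vimage)
    also have "\<dots> \<le> c * (measure M' U + e)"
    proof (rule mult_left_mono[OF _ c])
      have "measure D V < measure D B + e"
        using V(3) that by (simp add: D.emeasure_eq_measure ennreal_less_iff flip: ennreal_plus)
      then show "measure M' (circle_cis -` V) \<le> measure M' U + e"
        using B V(2) by (simp add: D_eq)
    qed
    finally show ?thesis .
  qed
  then have "\<forall>\<^sub>F e in at_right 0. measure M U \<le> c * (measure M' U + e)"
    by (auto simp: eventually_at_right_less eventually_at_filter)
  moreover have "((\<lambda>e. c * (measure M' U + e)) \<longlongrightarrow> c * (measure M' U + 0)) (at_right 0)"
    by (intro tendsto_intros)
  ultimately show ?thesis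
    by (metis add.right_neutral tendsto_lowerbound trivial_limit_at_right_real)
qed

text \<open>The comparison above with factor 1, applied in both directions. It identifies the
  measure in the case \<open>r = 0\<close>.\<close>

lemma prob_measures_eqI:
  assumes m: "m \<in> prob_measures" "m' \<in> prob_measures"
    and eq: "\<And>f :: circle \<Rightarrow> real. continuous_on UNIV f \<Longrightarrow> (\<integral>x. f x \<partial>m) = (\<integral>x. f x \<partial>m')"
  shows "m = m'"
proof (rule measure_eqI)
  show "sets m = sets m'" using m by (simp add: prob_measures_def)
  fix U assume "U \<in> sets m"
  then have U: "U \<in> sets borel" using m by (simp add: prob_measures_def)
  interpret a: prob_space m using m by (simp add: prob_measures_def)
  interpret b: prob_space m' using m by (simp add: prob_measures_def)
  have "measure m U \<le> 1 * measure m' U" "measure m' U \<le> 1 * measure m U"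
    by (rule measure_le_if_integral_le; use m U eq in simp)+
  then show "emeasure m U = emeasure m' U"
    by (simp add: a.emeasure_eq_measure b.emeasure_eq_measure)
qed

section \<open>Division into \<open>N\<close> equal arcs and weak* approximation\<close>

text \<open>The index runs over all integers, so that neighbours \<open>j - 1\<close> and
  differences \<open>j - k\<close> can be written without reduction modulo \<open>N\<close>.\<close>

definition circle_arc :: "nat \<Rightarrow> int \<Rightarrow> circle set" where
  "circle_arc N j = to_circle ` {of_int j / real N ..< (of_int j + 1) / real N}"

lemma borel_arc [measurable]: "circle_arc N j \<in> sets borel"
  unfolding circle_arc_def by (rule borel_to_circle_atLeastLessThan)

lemma rot_image_to_circle: "rot t ` to_circle ` {a..<b} = to_circle ` {a - t..<b - t}"
proof -
  have "{a - t..<b - t} = (\<lambda>x. x - t) ` {a..<b}"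
    using image_add_atLeastLessThan[of "- t" a b] by (simp add: image_def)
  then show ?thesis by (simp add: image_image)
qed

text \<open>Rotation by a multiple of \<open>1 / N\<close> permutes the arcs, so at
  \<open>t = 1 / N\<close> the inequality defining \<open>Omega_sub\<close> compares the masses of
  adjacent arcs.\<close>

lemma rot_image_arc: "0 < N \<Longrightarrow> rot (of_int k / real N) ` circle_arc N j = circle_arc N (j - k)"
  by (simp add: circle_arc_def rot_image_to_circle flip: diff_divide_distrib)
    (simp add: algebra_simps)

lemma rot_0 [simp]: "rot 0 = id"
proof
  fix x show "rot 0 x = id x"
    using surj_to_circle by (metis diff_zero eq_id_iff rot_to_circle surjD)
qed

text \<open>Shifting the index by \<open>N\<close> amounts to a full turn.\<close>

lemma circle_arc_periodic: "0 < N \<Longrightarrow> circle_arc N (j + int N) = circle_arc N j"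
proof -
  assume N: "0 < N"
  have "rot (of_int (- int N) / real N) = rot 0"
    using N by (intro rot_cong) simp
  then show ?thesis using rot_image_arc[OF N, of "- int N" j] by simp
qed

text \<open>For these \<open>j\<close> the interval that defines the arc lies inside the fundamental
  domain, where \<open>to_circle\<close> is injective.\<close>

lemma to_circle_in_arc_iff:
  assumes N: "0 < N" and j: "0 \<le> j" "j < int N" and y: "0 \<le> y" "y < 1"
  shows "to_circle y \<in> circle_arc N j \<longleftrightarrow> j = \<lfloor>real N * y\<rfloor>"
proof
  assume "to_circle y \<in> circle_arc N j"
  then obtain z where z: "to_circle y = to_circle z" "of_int j / real N \<le> z"
    "z < (of_int j + 1) / real N"
    by (auto simp: circle_arc_def)
  have "(of_int j + 1) / real N \<le> 1"
  proof -
    have "real_of_int (j + 1) \<le> real_of_int (int N)" using j by linarith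
    with N show ?thesis by simp
  qed
  moreover have "0 \<le> of_int j / real N" using j by simp
  ultimately have "z \<in> {0..<1}" using z by auto
  with y z(1) have "y = z"
    using bij_betw_to_circle by (auto simp: bij_betw_def inj_on_def)
  with z N show "j = \<lfloor>real N * y\<rfloor>"
    by (intro floor_unique[symmetric]) (auto simp: field_simps)
next
  assume "j = \<lfloor>real N * y\<rfloor>"
  then have "of_int j \<le> real N * y" "real N * y < of_int j + 1" by linarith+
  with N show "to_circle y \<in> circle_arc N j" by (auto simp: circle_arc_def field_simps)
qed

text \<open>Covering and disjointness of the arcs in one statement, together with the representative
  \<open>y\<close> needed to estimate the distance to the left endpoint.\<close>

lemma circle_arc_cover:
  assumes N: "0 < N"
  shows "\<exists>j\<in>{0..<int N}. \<exists>y\<in>{0..<1}. x = to_circle y \<and> j = \<lfloor>real N * y\<rfloor> \<and>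
    (\<forall>i\<in>{0..<int N}. x \<in> circle_arc N i \<longleftrightarrow> i = j)"
proof -
  have "x \<in> to_circle ` {0..<1}"
    using bij_betw_imp_surj_on[OF bij_betw_to_circle] by simp
  then obtain y where y: "x = to_circle y" "0 \<le> y" "y < 1" by auto
  have "0 \<le> \<lfloor>real N * y\<rfloor>" using y by simp
  moreover have "real N * y < real_of_int (int N)" using y N by simp
  then have "\<lfloor>real N * y\<rfloor> < int N" by (simp only: floor_less_iff)
  ultimately have "\<lfloor>real N * y\<rfloor> \<in> {0..<int N}" by simp
  moreover have "x \<in> circle_arc N i \<longleftrightarrow> i = \<lfloor>real N * y\<rfloor>" if "i \<in> {0..<int N}" for i
    unfolding y(1) by (rule to_circle_in_arc_iff[OF N _ _ y(2,3)]) (use that in simp_all)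
  ultimately show ?thesis using y by (metis atLeastLessThan_iff)
qed

lemma sum_measure_circle_arc:
  assumes m: "m \<in> prob_measures" and N: "0 < N"
  shows "(\<Sum>j\<in>{0..<int N}. measure m (circle_arc N j)) = 1"
proof -
  interpret prob_space m using m by (simp add: prob_measures_def)
  have "disjoint_family_on (circle_arc N) {0..<int N}"
    unfolding disjoint_family_on_def
  proof (intro ballI impI equals0I)
    fix i j x assume ij: "i \<in> {0..<int N}" "j \<in> {0..<int N}" "i \<noteq> j"
      and x: "x \<in> circle_arc N i \<inter> circle_arc N j"
    obtain k where "\<forall>i\<in>{0..<int N}. x \<in> circle_arc N i \<longleftrightarrow> i = k"
      using circle_arc_cover[OF N, of x] by blast
    with ij x show False by auto
  qed
  moreover have "(\<Union>j\<in>{0..<int N}. circle_arc N j) = UNIV"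
  proof (rule UNIV_eq_I[symmetric])
    fix x
    obtain k where "k \<in> {0..<int N}" "\<forall>i\<in>{0..<int N}. x \<in> circle_arc N i \<longleftrightarrow> i = k"
      using circle_arc_cover[OF N, of x] by blast
    then show "x \<in> (\<Union>j\<in>{0..<int N}. circle_arc N j)" by blast
  qed
  ultimately have "prob UNIV = (\<Sum>j\<in>{0..<int N}. prob (circle_arc N j))"
    using finite_measure_finite_Union[of "{0..<int N}" "circle_arc N"]
    by (simp add: prob_measures_facts(1)[OF m] image_subset_iff)
  then show ?thesis using prob_space by (simp add: prob_measures_facts(2)[OF m])
qed

text \<open>On every short arc a continuous function is close to its value at the left endpoint. The
  resulting step function has the same integral for both measures, so the error is at most
  \<open>2 * e / 3\<close>. The bound \<open>N0\<close> depends on \<open>f\<close> and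
  \<open>e\<close> only.\<close>

lemma integral_close_if_measure_arc_eq:
  fixes f :: "circle \<Rightarrow> real"
  assumes f: "continuous_on UNIV f" and e: "0 < e"
  shows "\<exists>N0>0. \<forall>N\<ge>N0. \<forall>m\<in>prob_measures. \<forall>m'\<in>prob_measures.
    (\<forall>j\<in>{0..<int N}. measure m (circle_arc N j) = measure m' (circle_arc N j)) \<longrightarrow>
      \<bar>(\<integral>x. f x \<partial>m) - (\<integral>x. f x \<partial>m')\<bar> < e"
proof -
  \<comment> \<open>Uniform continuity is taken for the lift on the closed interval, so no metric on
    the circle is involved.\<close>
  have "continuous_on {0..1} (\<lambda>x. f (to_circle x))"
    using continuous_on_compose2[OF f continuous_on_to_circle] continuous_on_subset by blast
  then have "uniformly_continuous_on {0..1} (\<lambda>x. f (to_circle x))"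
    by (rule compact_uniformly_continuous) simp
  then obtain d where d: "0 < d"
    "\<And>x y. \<lbrakk>x \<in> {0..1}; y \<in> {0..1}; dist y x < d\<rbrakk> \<Longrightarrow> dist (f (to_circle y)) (f (to_circle x)) < e / 3"
    unfolding uniformly_continuous_on_def using e by (metis zero_less_divide_iff zero_less_numeral)
  obtain N0 :: nat where N0: "N0 \<noteq> 0" "inverse (real N0) < d"
    using d(1) real_arch_inverse by blast
  show ?thesis
  proof (intro exI[of _ N0] conjI allI ballI impI)
    show "0 < N0" using N0 by simp
  next
    fix N m m'
    assume le: "N0 \<le> N" and ms: "m \<in> prob_measures" "m' \<in> prob_measures"
      and eq: "\<forall>j\<in>{0..<int N}. measure m (circle_arc N j) = measure m' (circle_arc N j)"
    have N: "0 < N" using le N0 by simp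
    have Nd: "1 / real N < d"
      using N0 le N by (intro le_less_trans[OF _ N0(2)]) (auto simp: field_simps)
    define S where "S m = (\<Sum>j\<in>{0..<int N}. f (to_circle (of_int j / real N)) * measure m (circle_arc N j))"
      for m
    have close: "\<bar>(\<integral>x. f x \<partial>m) - S m\<bar> \<le> e / 3" if m: "m \<in> prob_measures" for m
    proof -
      interpret prob_space m using m by (simp add: prob_measures_def)
      note s = prob_measures_facts(1,2)[OF m]
      define g where "g x = (\<Sum>j\<in>{0..<int N}. f (to_circle (of_int j / real N)) * indicator (circle_arc N j) x)"
        for x
      have int_g: "integrable m g"
        unfolding g_def using s by (intro Bochner_Integration.integrable_sum integrable_mult_right)
          (auto simp: emeasure_eq_measure)
      have "(\<integral>x. g x \<partial>m) = S m"
        unfolding g_def S_def using s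
        by (subst Bochner_Integration.integral_sum) (auto simp: emeasure_eq_measure)
      have "\<bar>f x - g x\<bar> \<le> e / 3" for x
      proof -
        obtain j y where j: "j \<in> {0..<int N}" "x = to_circle y" "0 \<le> y" "y < 1"
          "j = \<lfloor>real N * y\<rfloor>" "\<forall>i\<in>{0..<int N}. x \<in> circle_arc N i \<longleftrightarrow> i = j"
          using circle_arc_cover[OF N, of x] by auto
        have "g x = (\<Sum>i\<in>{0..<int N}. if i = j then f (to_circle (of_int j / real N)) else 0)"
          unfolding g_def by (intro sum.cong refl) (use j(6) in auto)
        also have "\<dots> = f (to_circle (of_int j / real N))" using j(1) by simp
        finally have g: "g x = f (to_circle (of_int j / real N))" .
        have *: "of_int j \<le> real N * y" "real N * y < of_int j + 1" using j(5) by linarith+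
        then have "of_int j / real N \<le> y" "y < of_int j / real N + 1 / real N"
          using N by (auto simp: field_simps)
        with Nd have "dist y (of_int j / real N) < d" by (auto simp: dist_real_def)
        moreover have "of_int j / real N \<in> {0..1}"
        proof -
          have "of_int j \<le> real N" using j(1) by auto
          then show ?thesis using j(1) N by (auto simp: field_simps)
        qed
        ultimately have "dist (f (to_circle y)) (f (to_circle (of_int j / real N))) < e / 3"
          using j by (intro d(2)) auto
        then show ?thesis using g by (simp add: j(2) dist_real_def)
      qed
      moreover have int_f: "integrable m f" using continuous_integrable[OF m f] .
      ultimately have "(\<integral>x. \<bar>f x - g x\<bar> \<partial>m) \<le> e / 3"
        using int_g by (intro integral_le_const) auto
      moreover have "\<bar>\<integral>x. f x - g x \<partial>m\<bar> \<le> (\<integral>x. \<bar>f x - g x\<bar> \<partial>m)"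
        by (rule integral_abs_bound)
      ultimately show ?thesis
        using int_f int_g \<open>(\<integral>x. g x \<partial>m) = S m\<close> by simp
    qed
    have "S m = S m'" unfolding S_def using eq by simp
    then show "\<bar>(\<integral>x. f x \<partial>m) - (\<integral>x. f x \<partial>m')\<bar> < e"
      using close[OF ms(1)] close[OF ms(2)] e by linarith
  qed
qed

text \<open>The chosen measures \<open>g N\<close> converge to \<open>m\<close>: they are eventually
  in every subbasic neighbourhood by the uniform estimate above, and this property survives finite
  intersections and unions.\<close>

lemma in_closure_of_weakstarI:
  assumes m: "m \<in> prob_measures" and S: "S \<subseteq> prob_measures"
    and approx: "\<And>N. 0 < N \<Longrightarrow>
      \<exists>m'\<in>S. \<forall>j\<in>{0..<int N}. measure m (circle_arc N j) = measure m' (circle_arc N j)"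
  shows "m \<in> weakstar closure_of S"
proof -
  obtain g where g: "\<And>N. 0 < N \<Longrightarrow> g N \<in> S"
    "\<And>N j. 0 < N \<Longrightarrow> j \<in> {0..<int N} \<Longrightarrow> measure m (circle_arc N j) = measure (g N) (circle_arc N j)"
    using approx by metis
  have ev: "\<forall>\<^sub>F N in sequentially. g N \<in> T" if "openin weakstar T" "m \<in> T" for T
  proof -
    have "generate_topology_on {{m \<in> prob_measures. (\<integral>x. f x \<partial>m) \<in> V} | (f :: circle \<Rightarrow> real) V.
        continuous_on UNIV f \<and> open V} T"
      using that(1) unfolding weakstar_def openin_topology_generated_by_iff .
    then show ?thesis using that(2)
    proof induction
      case Empty
      then show ?case by simp
    next
      case (Int a b)
      then show ?case by (auto intro: eventually_conj)
    next
      case (UN K)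
      then obtain k where "k \<in> K" "\<forall>\<^sub>F N in sequentially. g N \<in> k" by blast
      then show ?case by (auto elim!: eventually_mono)
    next
      case (Basis s)
      from Basis(1) obtain f :: "circle \<Rightarrow> real" and V
        where s: "s = {m \<in> prob_measures. (\<integral>x. f x \<partial>m) \<in> V}"
          and f: "continuous_on UNIV f" and V: "open V"
        unfolding mem_Collect_eq by (elim exE conjE)
      have mV: "(\<integral>x. f x \<partial>m) \<in> V" using Basis(2) unfolding s mem_Collect_eq by (rule conjunct2)
      obtain e where e: "0 < e" "\<forall>y. \<bar>y - (\<integral>x. f x \<partial>m)\<bar> < e \<longrightarrow> y \<in> V"
        using V mV unfolding open_dist dist_real_def by meson
      obtain N0 where N0: "0 < N0"
        "\<forall>N\<ge>N0. \<forall>m\<in>prob_measures. \<forall>m'\<in>prob_measures.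
          (\<forall>j\<in>{0..<int N}. measure m (circle_arc N j) = measure m' (circle_arc N j)) \<longrightarrow>
            \<bar>(\<integral>x. f x \<partial>m) - (\<integral>x. f x \<partial>m')\<bar> < e"
        using integral_close_if_measure_arc_eq[OF f e(1)] by blast
      have "g N \<in> s" if "N0 \<le> N" for N
      proof -
        have N: "0 < N" using that N0 by simp
        have gN: "g N \<in> prob_measures" using g(1)[OF N] S by blast
        have "\<bar>(\<integral>x. f x \<partial>m) - (\<integral>x. f x \<partial>g N)\<bar> < e"
          using N0(2) that m gN g(2)[OF N] by blast
        then show ?thesis using e(2) gN by (simp add: s abs_minus_commute)
      qed
      then show ?case by (auto simp: eventually_sequentially)
    qed
  qed
  show ?thesis
    unfolding in_closure_of topspace_weakstar
  proof (intro conjI allI impI m)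
    fix T assume "m \<in> T \<and> openin weakstar T"
    \<comment> \<open>Membership of \<open>g N\<close> in \<open>S\<close> is known only for
      positive \<open>N\<close>, hence the second conjunct.\<close>
    then have "\<forall>\<^sub>F N in sequentially. g N \<in> T \<and> 0 < N"
      using ev eventually_gt_at_top[of 0] by (auto intro: eventually_conj)
    from eventually_happens'[OF sequentially_bot this] obtain N where "g N \<in> T \<and> 0 < N" ..
    then show "\<exists>y. y \<in> S \<and> y \<in> T" using g(1) by blast
  qed
qed

section \<open>Finite convex combinations\<close>

text \<open>The mixture is realised as a measure by binding a finite discrete distribution with
  weights \<open>c\<close>. Indexing by \<open>I\<close> allows \<open>g\<close> to repeat a
  measure; the coefficients of equal measures are then added to fit the hull, which sums over a
  set.\<close>

lemma measure_convex_hull_sumI: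
  assumes K: "K \<subseteq> prob_measures" and I: "finite I" and g: "\<And>i. i \<in> I \<Longrightarrow> g i \<in> K"
    and c: "\<And>i. i \<in> I \<Longrightarrow> 0 \<le> c i" "(\<Sum>i\<in>I. c i) = (1 :: real)"
  shows "\<exists>m\<in>measure_convex_hull K. \<forall>U\<in>sets borel. measure m U = (\<Sum>i\<in>I. c i * measure (g i) U)"
proof -
  obtain i0 where i0: "i0 \<in> I" using c(2) by force
  \<comment> \<open>\<open>h\<close> extends \<open>g\<close> by a default member of
    \<open>K\<close>, since the kernel of the bind must give a probability measure at every index of
    the type.\<close>
  define h where "h i = (if i \<in> I then g i else g i0)" for i
  have h: "h i \<in> prob_measures" for i using g i0 K by (auto simp: h_def)
  define p where "p = embed_pmf (\<lambda>i. if i \<in> I then c i else 0)"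
  have p: "pmf p i = (if i \<in> I then c i else 0)" for i
    unfolding p_def
  proof (rule pmf_embed_pmf)
    have "(\<integral>\<^sup>+ x. ennreal (if x \<in> I then c x else 0) \<partial>count_space UNIV) =
        (\<integral>\<^sup>+ x. ennreal (c x) \<partial>count_space I)"
      by (subst nn_integral_count_space_indicator) (auto intro!: nn_integral_cong)
    also have "\<dots> = ennreal (\<Sum>x\<in>I. c x)"
      using I c(1) by (simp add: nn_integral_count_space_finite sum_ennreal)
    finally show "(\<integral>\<^sup>+ x. ennreal (if x \<in> I then c x else 0) \<partial>count_space UNIV) = 1"
      using c(2) by simp
  qed (use c in auto)
  define m where "m = measure_pmf p \<bind> h"
  have h_meas: "h \<in> measurable (measure_pmf p) (prob_algebra borel)"
    using h by (auto simp: measurable_def space_prob_algebra prob_measures_def)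
  have pr: "prob_space m"
    unfolding m_def
    by (rule prob_space_bind'[OF _ h_meas]) (simp add: space_prob_algebra measure_pmf.prob_space_axioms)
  have sm: "sets m = sets borel"
    unfolding m_def using h by (subst sets_bind[where N = borel]) (auto simp: prob_measures_def)
  have mU: "measure m U = (\<Sum>i\<in>I. c i * measure (g i) U)" if U: "U \<in> sets borel" for U
  proof -
    have "emeasure m U = (\<integral>\<^sup>+i. emeasure (h i) U \<partial>measure_pmf p)"
      unfolding m_def using U measurable_prob_algebraD[OF h_meas]
      by (intro emeasure_bind) auto
    also have "\<dots> = (\<Sum>i\<in>I. emeasure (h i) U * ennreal (pmf p i))"
      using I p by (intro nn_integral_measure_pmf_support) (auto simp: set_pmf_iff)
    also have "\<dots> = (\<Sum>i\<in>I. ennreal (c i * measure (g i) U))"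
    proof (rule sum.cong[OF refl])
      fix i assume i: "i \<in> I"
      then interpret prob_space "g i" using g K by (auto simp: prob_measures_def)
      show "emeasure (h i) U * ennreal (pmf p i) = ennreal (c i * measure (g i) U)"
        using i c(1) by (simp add: h_def p emeasure_eq_measure ennreal_mult mult.commute)
    qed
    also have "\<dots> = ennreal (\<Sum>i\<in>I. c i * measure (g i) U)"
      using c(1) by (intro sum_ennreal) auto
    finally show ?thesis
      using c(1) by (simp add: measure_def sum_nonneg)
  qed
  have "m \<in> measure_convex_hull K"
    unfolding measure_convex_hull_def
  proof (intro CollectI conjI exI ballI)
    show "m \<in> prob_measures" using sm pr by (simp add: prob_measures_def)
    show "finite (g ` I)" "g ` I \<subseteq> K" using I g by auto
    \<comment> \<open>Total weight of all indices whose measure is \<open>k\<close>.\<close>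
    let ?c = "\<lambda>k. \<Sum>i\<in>{i \<in> I. g i = k}. c i"
    show "0 \<le> ?c k" for k using c(1) by (auto intro: sum_nonneg)
    show "(\<Sum>k\<in>g ` I. ?c k) = 1"
      using c(2) sum.image_gen[OF I, of c g] by simp
    fix U :: "circle set" assume U: "U \<in> sets borel"
    have "(\<Sum>i\<in>I. c i * measure (g i) U) =
        (\<Sum>k\<in>g ` I. \<Sum>i\<in>{i \<in> I. g i = k}. c i * measure (g i) U)"
      by (rule sum.image_gen[OF I])
    also have "\<dots> = (\<Sum>k\<in>g ` I. ?c k * measure k U)"
      by (auto simp: sum_distrib_right intro!: sum.cong)
    finally show "measure m U = (\<Sum>k\<in>g ` I. ?c k * measure k U)"
      using mU[OF U] by simp
  qed
  with mU show ?thesis by blast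
qed

section \<open>Convexity, rotation invariance and weak* closedness of
  \<open>Omega_sub\<close>\<close>

lemma Omega_sub_subset: "Omega_sub r \<subseteq> prob_measures"
  by (auto simp: Omega_sub_def)

lemma Omega_subD:
  "\<lbrakk>m \<in> Omega_sub r; 0 \<le> t; U \<in> sets borel\<rbrakk> \<Longrightarrow>
    measure m (rot t ` U) \<le> exp (r * t) * measure m U"
  by (simp add: Omega_sub_def)

lemma measure_convex_hull_Omega_sub: "K \<subseteq> Omega_sub r \<Longrightarrow> measure_convex_hull K \<subseteq> Omega_sub r"
proof
  fix m assume K: "K \<subseteq> Omega_sub r" and "m \<in> measure_convex_hull K"
  then obtain F c where m: "m \<in> prob_measures" and F: "finite F" "F \<subseteq> K" "\<forall>k\<in>F. 0 \<le> c k"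
    and eq: "\<And>U. U \<in> sets borel \<Longrightarrow> measure m U = (\<Sum>k\<in>F. c k * measure k U)"
    unfolding measure_convex_hull_def by blast
  show "m \<in> Omega_sub r"
    unfolding Omega_sub_def
  proof (intro CollectI conjI m allI impI ballI)
    fix t :: real and U :: "circle set" assume t: "0 \<le> t" and U: "U \<in> sets borel"
    have "measure m (rot t ` U) = (\<Sum>k\<in>F. c k * measure k (rot t ` U))"
      using U by (intro eq borel_rot_image)
    also have "\<dots> \<le> (\<Sum>k\<in>F. c k * (exp (r * t) * measure k U))"
      using F K t U by (intro sum_mono mult_left_mono Omega_subD) auto
    also have "\<dots> = exp (r * t) * measure m U"
      by (simp add: eq[OF U] sum_distrib_left mult_ac)
    finally show "measure m (rot t ` U) \<le> exp (r * t) * measure m U" .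
  qed
qed

lemma comp_rot_prob_measures:
  assumes m: "m \<in> prob_measures"
  shows "comp_rot m s \<in> prob_measures"
proof -
  note sm = prob_measures_facts[OF m]
  have "rot (- s) \<in> measurable m borel"
    using measurable_rot measurable_cong_sets[OF sm(1) refl] by blast
  then show ?thesis
    using sm by (simp add: comp_rot_eq_distr prob_measures_def prob_space.prob_space_distr)
qed

lemma measure_comp_rot:
  "\<lbrakk>m \<in> prob_measures; U \<in> sets borel\<rbrakk> \<Longrightarrow> measure (comp_rot m s) U = measure m (rot s ` U)"
  by (simp add: measure_def emeasure_comp_rot prob_measures_facts)

lemma rot_image_commute: "rot s ` rot t ` U = rot t ` rot s ` U"
proof -
  have "rot s (rot t x) = rot t (rot s x)" for x
  proof -
    obtain y where "x = to_circle y" using surj_to_circle by blast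
    then show ?thesis by (simp add: algebra_simps)
  qed
  then show ?thesis by (simp add: image_image)
qed

text \<open>Rotations commute, so the inequality for \<open>m\<close> at the rotated Borel set is
  the inequality for \<open>comp_rot m s\<close>.\<close>

lemma comp_rot_Omega_sub:
  assumes m: "m \<in> Omega_sub r"
  shows "comp_rot m s \<in> Omega_sub r"
proof -
  have pm: "m \<in> prob_measures" using m Omega_sub_subset by blast
  then show ?thesis
    using Omega_subD[OF m]
    by (auto simp: Omega_sub_def comp_rot_prob_measures measure_comp_rot borel_rot_image
        rot_image_commute[of s])
qed

text \<open>The defining inequality says that \<open>comp_rot m t\<close> is dominated by
  \<open>exp (r * t)\<close> times \<open>m\<close> as a measure; integrating \<open>f\<close> gives
  the claim. The sign in \<open>rot (- t)\<close> appears because \<open>comp_rot m t\<close> is the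
  image of \<open>m\<close> under that map.\<close>

lemma Omega_sub_integral_le:
  fixes f :: "circle \<Rightarrow> real"
  assumes m: "m \<in> Omega_sub r" and t: "0 \<le> t"
    and f: "continuous_on UNIV f" "\<And>x. 0 \<le> f x"
  shows "(\<integral>x. f (rot (- t) x) \<partial>m) \<le> exp (r * t) * (\<integral>x. f x \<partial>m)"
proof -
  have pm: "m \<in> prob_measures" using m Omega_sub_subset by blast
  note sm = prob_measures_facts[OF pm]
  interpret prob_space m by (rule sm(3))
  have [measurable]: "f \<in> borel_measurable borel"
    by (rule borel_measurable_continuous_onI[OF f(1)])
  have meas: "rot (- t) \<in> measurable m borel"
    using measurable_rot measurable_cong_sets[OF sm(1) refl] by blast
  have f_meas: "f \<in> borel_measurable m"
    using \<open>f \<in> borel_measurable borel\<close> measurable_cong_sets[OF sm(1) refl] by blast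
  let ?D = "density m (\<lambda>_. ennreal (exp (r * t)))"
  have le: "comp_rot m t \<le> ?D"
  proof (rule le_measure[THEN iffD2])
    show "sets (comp_rot m t) = sets ?D"
      using comp_rot_prob_measures[OF pm] sm by (simp add: prob_measures_def)
    show "\<forall>A\<in>sets (comp_rot m t). emeasure (comp_rot m t) A \<le> emeasure ?D A"
    proof
      fix U assume "U \<in> sets (comp_rot m t)"
      then have U: "U \<in> sets borel"
        using comp_rot_prob_measures[OF pm] by (simp add: prob_measures_def)
      have "emeasure (comp_rot m t) U = ennreal (measure m (rot t ` U))"
        using U by (simp add: emeasure_comp_rot sm emeasure_eq_measure)
      also have "\<dots> \<le> ennreal (exp (r * t) * measure m U)"
        using Omega_subD[OF m t U] by (rule ennreal_leI)
      also have "\<dots> = emeasure ?D U"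
        using U by (simp add: emeasure_density_const sm emeasure_eq_measure ennreal_mult)
      finally show "emeasure (comp_rot m t) U \<le> emeasure ?D U" .
    qed
  qed
  have int: "integrable m f" by (rule continuous_integrable[OF pm f(1)])
  have int': "integrable m (\<lambda>x. f (rot (- t) x))"
    using continuous_on_compose2[OF f(1) continuous_on_rot] by (intro continuous_integrable[OF pm]) auto
  have "ennreal (\<integral>x. f (rot (- t) x) \<partial>m) = (\<integral>\<^sup>+x. ennreal (f (rot (- t) x)) \<partial>m)"
    using int' f(2) by (simp add: nn_integral_eq_integral)
  also have "\<dots> = (\<integral>\<^sup>+x. ennreal (f x) \<partial>comp_rot m t)"
    using meas by (simp add: comp_rot_eq_distr sm nn_integral_distr)
  also have "\<dots> \<le> (\<integral>\<^sup>+x. ennreal (f x) \<partial>?D)"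
    using comp_rot_prob_measures[OF pm] sm le
    by (intro nn_integral_mono_measure) (auto simp: prob_measures_def)
  also have "\<dots> = ennreal (exp (r * t)) * (\<integral>\<^sup>+x. ennreal (f x) \<partial>m)"
    using f_meas by (simp add: nn_integral_density nn_integral_cmult)
  also have "\<dots> = ennreal (exp (r * t) * (\<integral>x. f x \<partial>m))"
    using int f(2) by (simp add: nn_integral_eq_integral ennreal_mult)
  finally show ?thesis
    using f(2) by (subst (asm) ennreal_le_iff) (auto intro!: mult_nonneg_nonneg integral_nonneg)
qed

text \<open>The inequality for Borel sets is not visibly a weak* closed condition, but its version
  for continuous functions is: it bounds the integral of a fixed continuous function by 0.
  Regularity then leads back from functions to Borel sets.\<close>

lemma closedin_Omega_sub: "closedin weakstar (Omega_sub r)"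
  unfolding closure_of_subset_eq[symmetric] topspace_weakstar
proof (intro conjI Omega_sub_subset subsetI)
  fix m assume cl: "m \<in> weakstar closure_of Omega_sub r"
  then have m: "m \<in> prob_measures"
    using closure_of_subset_topspace[of weakstar "Omega_sub r"] by (auto simp: topspace_weakstar)
  note sm = prob_measures_facts[OF m]
  show "m \<in> Omega_sub r"
    unfolding Omega_sub_def
  proof (intro CollectI conjI m allI impI ballI)
    fix t :: real and U :: "circle set" assume t: "0 \<le> t" and U: "U \<in> sets borel"
    have "measure (comp_rot m t) U \<le> exp (r * t) * measure m U"
    proof (rule measure_le_if_integral_le[OF comp_rot_prob_measures[OF m] m _ _ U])
      fix f :: "circle \<Rightarrow> real" assume f: "continuous_on UNIV f" "\<And>x. 0 \<le> f x"
      have rf: "continuous_on UNIV (\<lambda>x. f (rot (- t) x))"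
        using continuous_on_compose2[OF f(1) continuous_on_rot] by auto
      define h where "h x = f (rot (- t) x) - exp (r * t) * f x" for x
      have h: "continuous_on UNIV h"
        unfolding h_def using rf f(1) by (intro continuous_intros)
      have h_int: "(\<integral>x. h x \<partial>k) = (\<integral>x. f (rot (- t) x) \<partial>k) - exp (r * t) * (\<integral>x. f x \<partial>k)"
        if "k \<in> prob_measures" for k
        unfolding h_def using continuous_integrable[OF that] rf f(1) by simp
      have "(\<integral>x. h x \<partial>m) \<le> 0"
      proof (rule ccontr)
        \<comment> \<open>A violation at \<open>m\<close> is an open condition, so some
          \<open>k\<close> in \<open>Omega_sub r\<close> would violate the inequality as
          well.\<close>
        define T where "T = {k \<in> prob_measures. (\<integral>x. h x \<partial>k) \<in> {0<..}}"
        assume "\<not> (\<integral>x. h x \<partial>m) \<le> 0"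
        then have "m \<in> T" using m by (simp add: T_def)
        moreover have "openin weakstar T"
          unfolding T_def weakstar_def
          by (intro topology_generated_by_Basis CollectI exI[of _ h] exI[of _ "{0<..}"] conjI refl h
              open_greaterThan)
        ultimately obtain k where "k \<in> Omega_sub r" "k \<in> T"
          using cl unfolding in_closure_of by blast
        then show False using Omega_sub_integral_le[OF _ t f, of k r] h_int[of k] by (simp add: T_def)
      qed
      moreover have "(\<integral>x. f x \<partial>comp_rot m t) = (\<integral>x. f (rot (- t) x) \<partial>m)"
      proof -
        have "rot (- t) \<in> measurable m borel"
          using measurable_rot measurable_cong_sets[OF sm(1) refl] by blast
        then show ?thesis
          using borel_measurable_continuous_onI[OF f(1)]
          by (simp add: comp_rot_eq_distr sm integral_distr)
      qed
      ultimately show "(\<integral>x. f x \<partial>comp_rot m t) \<le> exp (r * t) * (\<integral>x. f x \<partial>m)"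
        using h_int[OF m] by simp
    qed simp
    then show "measure m (rot t ` U) \<le> exp (r * t) * measure m U"
      using measure_comp_rot[OF m U] by simp
  qed
qed

section \<open>Membership of \<open>exp_measure r\<close> in \<open>Omega_sub r\<close>\<close>

lemma W_density_measurable [measurable]: "W_density r \<in> borel_measurable borel"
  unfolding W_density_def by measurable

lemma W_density_nonneg: "0 \<le> r \<Longrightarrow> 0 \<le> W_density r x"
  by (auto simp: W_density_def)

lemma W_density_antimono: "\<lbrakk>0 \<le> r; x \<le> y\<rbrakk> \<Longrightarrow> W_density r y \<le> W_density r x"
  by (auto simp: W_density_def intro!: divide_right_mono mult_left_mono)

text \<open>\<open>W_density r\<close> is the exponential on the whole line, not a periodic
  extension; the wrap-around at 1 is handled separately through
  \<open>W_density_antimono\<close>.\<close>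

lemma W_density_shift: "W_density r (x - t) = exp (r * t) * W_density r x"
  by (cases "r = 0") (simp_all add: W_density_def mult_exp_exp algebra_simps)

lemma exp_measure_0: "exp_measure 0 = lebesgue_circle"
  by (simp add: exp_measure_def lebesgue_circle_def W_density_def density_1)

lemma emeasure_exp_measure_indicator:
  assumes "U \<in> sets borel"
  shows "emeasure (exp_measure r) U =
    (\<integral>\<^sup>+x. ennreal (W_density r x) * indicator {0..<1} x * indicator (to_circle -` U) x \<partial>lborel)"
  unfolding emeasure_exp_measure[OF assms] by (auto intro!: nn_integral_cong simp: indicator_def)

lemma sets_exp_measure: "sets (exp_measure r) = sets borel"
  by (simp add: exp_measure_def)

lemma emeasure_exp_measure_arc:
  assumes r: "0 < r" and ab: "0 \<le> a" "a \<le> b" "b \<le> 1"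
  shows "emeasure (exp_measure r) (to_circle ` {a..<b}) =
    ennreal ((exp (- r * a) - exp (- r * b)) / (1 - exp (- r)))"
proof -
  have eq: "{0..<1} \<inter> to_circle -` to_circle ` {a..<b} = {a..<b}"
  proof (intro set_eqI iffI)
    fix x assume "x \<in> {0..<1} \<inter> to_circle -` to_circle ` {a..<b}"
    then obtain y where y: "y \<in> {a..<b}" "to_circle x = to_circle y" and x: "x \<in> {0..<1}" by auto
    have "y \<in> {0..<1}" using y(1) ab by auto
    with x y show "x \<in> {a..<b}"
      using inj_onD[OF bij_betw_imp_inj_on[OF bij_betw_to_circle]] by metis
  qed (use ab in auto)
  have "emeasure (exp_measure r) (to_circle ` {a..<b}) =
      (\<integral>\<^sup>+x. ennreal (W_density r x) * indicator {a..<b} x \<partial>lborel)"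
    by (simp add: emeasure_exp_measure borel_to_circle_atLeastLessThan eq)
  \<comment> \<open>The fundamental theorem of calculus is applied on a closed interval; the added
    endpoint is null.\<close>
  also have "\<dots> = (\<integral>\<^sup>+x. ennreal (W_density r x) * indicator {a..b} x \<partial>lborel)"
    using AE_lborel_singleton[of b] by (intro nn_integral_cong_AE) (auto split: split_indicator)
  also have "\<dots> = ennreal (- exp (- r * b) / (1 - exp (- r)) - - exp (- r * a) / (1 - exp (- r)))"
  proof (rule nn_integral_FTC_Icc)
    fix x
    show "0 \<le> W_density r x" using r by (intro W_density_nonneg) simp
    show "((\<lambda>x. - exp (- r * x) / (1 - exp (- r))) has_real_derivative W_density r x) (at x)"
      using r by (auto simp: W_density_def intro!: derivative_eq_intros)
  qed (use ab in simp_all)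
  finally show ?thesis by (simp add: diff_divide_distrib)
qed

lemma exp_measure_prob_measures: "0 \<le> r \<Longrightarrow> exp_measure r \<in> prob_measures"
proof -
  assume r: "0 \<le> r"
  have "to_circle ` {0..<1} = UNIV" using bij_betw_to_circle by (simp add: bij_betw_def)
  \<comment> \<open>The arc formula divides by \<open>1 - exp (- r)\<close>, so \<open>r = 0\<close>
    is computed from the density instead.\<close>
  then have "emeasure (exp_measure r) UNIV = 1"
    using r emeasure_exp_measure_arc[of r 0 1] emeasure_exp_measure_indicator[of UNIV 0]
    by (cases "r = 0") (auto simp: W_density_def)
  then show ?thesis
    using sets_eq_imp_space_eq[OF sets_exp_measure[of r]]
    by (auto simp: prob_measures_def sets_exp_measure intro!: prob_spaceI)
qed

text \<open>After a translation by \<open>t\<close> the integral runs over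
  \<open>[t, 1 + t)\<close>. The part beyond 1 is moved back to \<open>[0, t)\<close> by periodicity
  of \<open>V\<close>; there the density is \<open>W_density r (1 + x - t)\<close>, at most
  \<open>W_density r (x - t)\<close>, which is \<open>exp (r * t) * W_density r x\<close>.\<close>

lemma emeasure_exp_measure_rot_le:
  assumes r: "0 \<le> r" and t: "0 \<le> t" "t < 1" and U: "U \<in> sets borel"
  shows "emeasure (exp_measure r) (rot t ` U) \<le> ennreal (exp (r * t)) * emeasure (exp_measure r) U"
proof -
  define V where "V = to_circle -` U"
  have [measurable]: "V \<in> sets borel"
    unfolding V_def using measurable_sets_borel[OF measurable_to_circle U] .
  have V: "1 + x \<in> V \<longleftrightarrow> x \<in> V" for x
    using to_circle_add_int[of x 1] by (simp add: V_def add.commute)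
  let ?w = "\<lambda>x. ennreal (W_density r x)"
  have "inj (rot t)" by (rule inj_on_inverseI[of _ "rot (- t)"]) simp
  then have "to_circle x \<in> rot t ` U \<longleftrightarrow> x + t \<in> V" for x
    using inj_image_mem_iff[of "rot t" "to_circle (x + t)" U] by (simp add: V_def)
  then have rV: "to_circle -` rot t ` U = {x. x + t \<in> V}" by auto
  have "emeasure (exp_measure r) (rot t ` U) =
      (\<integral>\<^sup>+x. ?w x * indicator {0..<1} x * indicator V (x + t) \<partial>lborel)"
    unfolding emeasure_exp_measure_indicator[OF borel_rot_image[OF U]] rV by (simp add: indicator_def)
  also have "\<dots> = (\<integral>\<^sup>+x. ?w (x - t) * indicator {0..<1} (x - t) * indicator V x \<partial>lborel)"
    by (subst nn_integral_real_affine[where c = 1 and t = t]) (auto simp: add.commute)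
  also have "\<dots> = (\<integral>\<^sup>+x. ?w (x - t) * indicator {t..<1} x * indicator V x
      + ?w (x - t) * indicator {1..<1 + t} x * indicator V x \<partial>lborel)"
    using t by (intro nn_integral_cong) (auto split: split_indicator)
  also have "\<dots> = (\<integral>\<^sup>+x. ?w (x - t) * indicator {t..<1} x * indicator V x \<partial>lborel)
      + (\<integral>\<^sup>+x. ?w (x - t) * indicator {1..<1 + t} x * indicator V x \<partial>lborel)"
    by (intro nn_integral_add) auto
  also have "(\<integral>\<^sup>+x. ?w (x - t) * indicator {1..<1 + t} x * indicator V x \<partial>lborel) =
      (\<integral>\<^sup>+x. ?w (1 + x - t) * indicator {0..<t} x * indicator V x \<partial>lborel)"
    by (subst nn_integral_real_affine[where c = 1 and t = 1])
      (auto intro!: nn_integral_cong simp: V split: split_indicator)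
  also have "(\<integral>\<^sup>+x. ?w (x - t) * indicator {t..<1} x * indicator V x \<partial>lborel) + \<dots> =
      (\<integral>\<^sup>+x. ?w (x - t) * indicator {t..<1} x * indicator V x
        + ?w (1 + x - t) * indicator {0..<t} x * indicator V x \<partial>lborel)"
    by (intro nn_integral_add[symmetric]) auto
  also have "\<dots> \<le> (\<integral>\<^sup>+x. ennreal (exp (r * t)) * (?w x * indicator {0..<1} x * indicator V x) \<partial>lborel)"
  proof (intro nn_integral_mono)
    fix x
    have "?w (1 + x - t) \<le> ?w (x - t)"
      using r by (intro ennreal_leI W_density_antimono) auto
    moreover have "?w (x - t) = ennreal (exp (r * t)) * ?w x"
      using W_density_nonneg[OF r] by (simp add: W_density_shift ennreal_mult)
    ultimately show "?w (x - t) * indicator {t..<1} x * indicator V x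
        + ?w (1 + x - t) * indicator {0..<t} x * indicator V x
        \<le> ennreal (exp (r * t)) * (?w x * indicator {0..<1} x * indicator V x)"
      using t by (auto split: split_indicator)
  qed
  also have "\<dots> = ennreal (exp (r * t)) * emeasure (exp_measure r) U"
    unfolding emeasure_exp_measure_indicator[OF U] V_def[symmetric] by (intro nn_integral_cmult) auto
  finally show ?thesis .
qed

text \<open>Rotation depends on \<open>t\<close> modulo 1 only, and passing from \<open>t\<close> to
  \<open>frac t\<close> does not increase the factor \<open>exp (r * t)\<close>, as \<open>r\<close>
  and \<open>t\<close> are nonnegative.\<close>

lemma exp_measure_Omega_sub:
  assumes r: "0 \<le> r"
  shows "exp_measure r \<in> Omega_sub r"
  unfolding Omega_sub_def
proof (intro CollectI conjI exp_measure_prob_measures r allI impI ballI)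
  fix t :: real and U :: "circle set" assume t: "0 \<le> t" and U: "U \<in> sets borel"
  interpret prob_space "exp_measure r"
    using exp_measure_prob_measures[OF r] by (simp add: prob_measures_def)
  have "emeasure (exp_measure r) (rot (frac t) ` U)
      \<le> ennreal (exp (r * frac t)) * emeasure (exp_measure r) U"
    using r U by (intro emeasure_exp_measure_rot_le) (auto simp: frac_lt_1)
  then have "ennreal (measure (exp_measure r) (rot (frac t) ` U))
      \<le> ennreal (exp (r * frac t) * measure (exp_measure r) U)"
    by (simp add: emeasure_eq_measure ennreal_mult)
  then have "measure (exp_measure r) (rot (frac t) ` U) \<le> exp (r * frac t) * measure (exp_measure r) U"
    by (subst (asm) ennreal_le_iff) auto
  also have "\<dots> \<le> exp (r * t) * measure (exp_measure r) U"
    using r t by (intro mult_right_mono) (auto simp: frac_def intro!: mult_left_mono)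
  also have "rot (frac t) = rot t" by (rule rot_cong) (simp add: frac_def)
  finally show "measure (exp_measure r) (rot t ` U) \<le> exp (r * t) * measure (exp_measure r) U" .
qed

section \<open>Cyclic recurrences for the arc masses\<close>

text \<open>Applied to the differences \<open>d j\<close> of the masses of two measures on the arcs
  \<open>[j/N, (j+1)/N)\<close>, where periodicity gives the cyclic condition \<open>cyc\<close>.\<close>

lemma cyclic_recurrence_zero:
  fixes d :: "int \<Rightarrow> real"
  assumes q: "1 < q" and N: "0 < N"
    and rec: "\<And>j. j \<in> {0..<int N} \<Longrightarrow> q * d j = d (j - 1)" and cyc: "d (- 1) = d (int N - 1)"
    and j: "j \<in> {0..<int N}"
  shows "d j = 0"
proof -
  \<comment> \<open>The exponent is offset by one from the index, so that \<open>n = 0\<close>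
    starts at \<open>d (- 1)\<close>; at \<open>n = N\<close> the cycle closes.\<close>
  have pow: "q ^ n * d (int n - 1) = d (- 1)" if "n \<le> N" for n
    using that
  proof (induction n)
    case (Suc n)
    have "q ^ Suc n * d (int (Suc n) - 1) = q ^ n * (q * d (int n))" by simp
    also have "q * d (int n) = d (int n - 1)" using Suc.prems by (intro rec) simp
    finally show ?case using Suc by simp
  qed simp
  have "q ^ N * d (- 1) = d (- 1)" using pow[of N] cyc by simp
  moreover have "q ^ N \<noteq> 1" using one_less_power[OF q N] by simp
  ultimately have "d (- 1) = 0" by simp
  moreover have "nat (j + 1) \<le> N" using j by auto
  then have "q ^ nat (j + 1) * d j = d (- 1)" using pow[of "nat (j + 1)"] j by simp
  ultimately show ?thesis using q by simp
qed

lemma measure_exp_measure_circle_arc: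
  assumes r: "0 < r" and N: "0 < N" and i: "i \<in> {0..<int N}"
  shows "measure (exp_measure r) (circle_arc N i) =
    (exp (- r * (of_int i / N)) - exp (- r * ((of_int i + 1) / N))) / (1 - exp (- r))"
proof -
  have "i + 1 \<le> int N" using i by simp
  then have "real_of_int i + 1 \<le> real N" by linarith
  then have "emeasure (exp_measure r) (circle_arc N i) =
    ennreal ((exp (- r * (of_int i / N)) - exp (- r * ((of_int i + 1) / N))) / (1 - exp (- r)))"
    unfolding circle_arc_def using N i
    by (intro emeasure_exp_measure_arc r) (auto simp: divide_right_mono)
  moreover have "0 \<le> (exp (- r * (of_int i / N)) - exp (- r * ((of_int i + 1) / N))) / (1 - exp (- r))"
    using r by (intro divide_nonneg_nonneg) (auto simp: divide_right_mono)
  ultimately show ?thesis by (simp add: measure_def)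
qed

text \<open>The range of \<open>i\<close> is that of differences of two indices in
  \<open>{0..<int N}\<close>; 0 is the only multiple of \<open>N\<close> in it, so the jump of the
  density is met only there.\<close>

lemma exp_measure_arc_recurrence:
  assumes r: "0 < r" and N: "0 < N" and i: "- int N < i" "i < int N"
  shows "exp (r / N) * measure (exp_measure r) (circle_arc N i)
      - measure (exp_measure r) (circle_arc N (i - 1)) = (if i = 0 then exp (r / N) - 1 else 0)"
proof -
  let ?e = "\<lambda>i. measure (exp_measure r) (circle_arc N i)"
  let ?q = "exp (r / N)"
  have rec: "?q * ?e i - ?e (i - 1) = 0" if "i \<in> {1..<int N}" for i
  proof -
    have "?q * exp (- r * (real_of_int i / N)) = exp (- r * ((real_of_int i - 1) / N))"
      "?q * exp (- r * ((real_of_int i + 1) / N)) = exp (- r * (real_of_int i / N))"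
      using N by (simp_all add: exp_add[symmetric] field_simps)
    then have "?q * ?e i = ?e (i - 1)"
      using that r by (simp add: measure_exp_measure_circle_arc[OF r N] right_diff_distrib)
    then show ?thesis by simp
  qed
  show ?thesis
  proof (cases "i = 0")
    case True
    \<comment> \<open>Before arc 0 comes the last arc, for which the explicit formula is
      available.\<close>
    have a: "?e (0 - 1) = ?e (int N - 1)" using circle_arc_periodic[OF N, of "0 - 1"] by (simp add: add.commute)
    have b: "exp (- r * ((real N - 1) / N)) = ?q * exp (- r)"
      using N by (simp add: exp_add[symmetric] field_simps)
    have c: "?q * exp (- r / N) = 1" by (simp add: exp_add[symmetric])
    have ne: "1 - exp (- r) \<noteq> 0" using r by simp
    have "?e (int N - 1) * (1 - exp (- r)) = ?q * exp (- r) - exp (- r)"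
      using N b ne by (simp add: measure_exp_measure_circle_arc[OF r N])
    moreover have "?q * (?e 0 * (1 - exp (- r))) = ?q * (1 - exp (- r / N))"
      using N ne by (simp add: measure_exp_measure_circle_arc[OF r N])
    ultimately have "(?q * ?e 0 - ?e (0 - 1)) * (1 - exp (- r)) = (?q - 1) * (1 - exp (- r))"
      unfolding a left_diff_distrib mult.assoc using c by (simp add: algebra_simps)
    with ne True show ?thesis by simp
  next
    case False
    \<comment> \<open>A negative \<open>i\<close> is moved into the range of \<open>rec\<close> by
      adding \<open>N\<close>.\<close>
    then consider "i \<in> {1..<int N}" | "i + int N \<in> {1..<int N}" using i by fastforce
    then show ?thesis
    proof cases
      case 2
      then show ?thesis
        using rec[of "i + int N"] circle_arc_periodic[OF N, of i] circle_arc_periodic[OF N, of "i - 1"] False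
        by (simp add: algebra_simps)
    qed (use rec[of i] False in simp)
  qed
qed

text \<open>Up to the factor \<open>q - 1\<close>, the arc masses of \<open>exp_measure r\<close>
  are the fundamental solution of the cyclic operator taking \<open>f\<close> to
  \<open>q * f j - f (j - 1)\<close>. Convolving them with \<open>c\<close> therefore reproduces the
  masses of \<open>m\<close>.\<close>

lemma ex_convex_combination_arc_eq:
  assumes r: "0 < r" and N: "0 < N" and m: "m \<in> Omega_sub r"
  shows "\<exists>m'\<in>measure_convex_hull {comp_rot (exp_measure r) s | s. 0 \<le> s \<and> s < 1}.
    \<forall>j\<in>{0..<int N}. measure m (circle_arc N j) = measure m' (circle_arc N j)"
proof -
  let ?K = "{comp_rot (exp_measure r) s | s. 0 \<le> s \<and> s < 1}"
  have pm: "m \<in> prob_measures" using m Omega_sub_subset by blast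
  have E: "exp_measure r \<in> prob_measures" using r by (simp add: exp_measure_prob_measures)
  define q where "q = exp (r / N)"
  have q: "1 < q" using r N by (simp add: q_def)
  define a where "a j = measure m (circle_arc N j)" for j
  define e where "e j = measure (exp_measure r) (circle_arc N j)" for j
  \<comment> \<open>For \<open>m = \<integral> m\<^sub>r \<circ> R\<^sub>s d\<nu>(s)\<close> the mixing measure is the limit of
    \<open>(q m - m \<circ> R\<^bsub>1/N\<^esub>) / (q - 1)\<close>, which is nonnegative by the defining
    inequality of \<open>Omega_sub\<close>; \<open>c k\<close> is its mass on the \<open>k\<close>-th arc.\<close>
  define c where "c k = (q * a k - a (k - 1)) / (q - 1)" for k
  have per: "a (j + int N) = a j" "e (j + int N) = e j" for j
    by (simp_all add: a_def e_def circle_arc_periodic[OF N])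
  have sum_a: "(\<Sum>j\<in>{0..<int N}. a j) = 1"
    unfolding a_def by (rule sum_measure_circle_arc[OF pm N])
  \<comment> \<open>The shifted sum runs over the same cycle: the arc with index \<open>-1\<close>
    is the one with index \<open>N - 1\<close>.\<close>
  have "(\<Sum>j\<in>{0..<int N}. a (j - 1)) = (\<Sum>j\<in>{-1..<int N - 1}. a j)"
    by (rule sum.reindex_bij_witness[of _ "\<lambda>j. j + 1" "\<lambda>j. j - 1"]) auto
  also have "{-1..<int N - 1} = insert (-1) {0..<int N - 1}" using N by auto
  also have "(\<Sum>j\<in>\<dots>. a j) = a (int N - 1) + (\<Sum>j\<in>{0..<int N - 1}. a j)"
    using per(1)[of "-1"] by (simp add: add.commute)
  also have "\<dots> = (\<Sum>j\<in>insert (int N - 1) {0..<int N - 1}. a j)" by simp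
  also have "insert (int N - 1) {0..<int N - 1} = {0..<int N}" using N by auto
  finally have sum_a': "(\<Sum>j\<in>{0..<int N}. a (j - 1)) = 1" using sum_a by simp
  have c_nonneg: "0 \<le> c k" for k
  proof -
    have "a (k - 1) \<le> q * a k"
      using Omega_subD[OF m, of "1 / real N" "circle_arc N k"] rot_image_arc[OF N, of 1 k]
      by (simp add: a_def q_def)
    with q show ?thesis by (simp add: c_def)
  qed
  have sum_c: "(\<Sum>k\<in>{0..<int N}. c k) = 1"
    using q sum_a sum_a'
    by (simp add: c_def sum_divide_distrib[symmetric] sum_subtractf sum_distrib_left[symmetric])
  have "\<exists>m'\<in>measure_convex_hull ?K. \<forall>U\<in>sets borel.
      measure m' U = (\<Sum>k\<in>{0..<int N}. c k * measure (comp_rot (exp_measure r) (of_int k / N)) U)"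
  proof (rule measure_convex_hull_sumI)
    show "?K \<subseteq> prob_measures" using comp_rot_prob_measures[OF E] by blast
    show "comp_rot (exp_measure r) (of_int k / N) \<in> ?K" if "k \<in> {0..<int N}" for k
    proof -
      have "real_of_int k < real N" using that by auto
      then have "0 \<le> of_int k / real N" "of_int k / real N < 1" using that N by auto
      then show ?thesis by blast
    qed
  qed (use c_nonneg sum_c in auto)
  then obtain m' where m': "m' \<in> measure_convex_hull ?K" "\<And>U. U \<in> sets borel \<Longrightarrow>
      measure m' U = (\<Sum>k\<in>{0..<int N}. c k * measure (comp_rot (exp_measure r) (of_int k / N)) U)"
    by blast
  \<comment> \<open>Rotation by \<open>k / N\<close> shifts arc indices by \<open>k\<close>, so the
    arc masses of \<open>m'\<close> are the cyclic convolution of \<open>c\<close> with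
    \<open>e\<close>.\<close>
  define b where "b j = (\<Sum>k\<in>{0..<int N}. c k * e (j - k))" for j
  have b: "measure m' (circle_arc N j) = b j" for j
    by (simp add: m'(2) b_def e_def measure_comp_rot[OF E] rot_image_arc[OF N])
  have rec_b: "q * b j - b (j - 1) = q * a j - a (j - 1)" if j: "j \<in> {0..<int N}" for j
  proof -
    have "q * b j - b (j - 1) = (\<Sum>k\<in>{0..<int N}. c k * (q * e (j - k) - e (j - k - 1)))"
      by (simp add: b_def sum_distrib_left sum_subtractf[symmetric] algebra_simps)
    also have "\<dots> = (\<Sum>k\<in>{0..<int N}. if k = j then c j * (q - 1) else 0)"
    proof (rule sum.cong[OF refl])
      fix k assume "k \<in> {0..<int N}"
      then have "q * e (j - k) - e (j - k - 1) = (if j - k = 0 then q - 1 else 0)"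
        unfolding q_def e_def using j by (intro exp_measure_arc_recurrence[OF r N]) auto
      then show "c k * (q * e (j - k) - e (j - k - 1)) = (if k = j then c j * (q - 1) else 0)"
        by auto
    qed
    also have "\<dots> = c j * (q - 1)" using j by simp
    also have "\<dots> = q * a j - a (j - 1)" using q by (simp add: c_def)
    finally show ?thesis .
  qed
  \<comment> \<open>Periodicity of \<open>b\<close> and \<open>a\<close>, used at \<open>-1\<close>,
    supplies the cyclic hypothesis of \<open>cyclic_recurrence_zero\<close>.\<close>
  have "b (j + int N) = b j" for j
    unfolding b_def using per(2)[of "j - _"] by (simp add: algebra_simps)
  from this[of "-1"] per(1)[of "-1"] have "b (-1) - a (-1) = b (int N - 1) - a (int N - 1)"
    by (simp add: add.commute)
  then have ba: "b j - a j = 0" if "j \<in> {0..<int N}" for j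
    using rec_b that
    by (intro cyclic_recurrence_zero[OF q N, of "\<lambda>j. b j - a j" j]) (auto simp: algebra_simps)
  show ?thesis
  proof (intro bexI[OF _ m'(1)] ballI)
    fix j assume "j \<in> {0..<int N}"
    with ba b show "measure m (circle_arc N j) = measure m' (circle_arc N j)" by (simp add: a_def)
  qed
qed

section \<open>The case \<open>r = 0\<close> and the conclusion\<close>

text \<open>With factor 1 the masses do not decrease along the indices, and periodicity forces such
  a sequence to be constant; the total mass fixes the value.\<close>

lemma Omega_sub_0_measure_arc:
  assumes m: "m \<in> Omega_sub 0" and N: "0 < N" and j: "j \<in> {0..<int N}"
  shows "measure m (circle_arc N j) = 1 / N"
proof -
  have pm: "m \<in> prob_measures" using m Omega_sub_subset by blast
  define a where "a j = measure m (circle_arc N j)" for j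
  have step: "a (j - 1) \<le> a j" for j
    using Omega_subD[OF m, of "1 / real N" "circle_arc N j"] rot_image_arc[OF N, of 1 j]
    by (simp add: a_def)
  have mono: "a i \<le> a (i + int n)" for i n
  proof (induction n)
    case (Suc n)
    then show ?case using step[of "i + int n + 1"] by (simp add: add.commute add.left_commute)
  qed simp
  have const: "a i = a 0" if "i \<in> {0..<int N}" for i
  proof (rule antisym)
    show "a 0 \<le> a i" using mono[of 0 "nat i"] that by simp
    have "a i \<le> a (0 + int N)" using mono[of i "nat (int N - i)"] that by simp
    then show "a i \<le> a 0" unfolding a_def circle_arc_periodic[OF N] .
  qed
  have "(\<Sum>i\<in>{0..<int N}. a i) = (\<Sum>i\<in>{0..<int N}. a 0)"
    by (intro sum.cong refl const)
  then have "real N * a 0 = 1" using sum_measure_circle_arc[OF pm N] by (simp add: a_def)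
  then show ?thesis using const[OF j] N by (simp add: a_def field_simps)
qed

text \<open>Both measures have mass \<open>1 / N\<close> on each of the \<open>N\<close> arcs for
  every positive \<open>N\<close>, so their integrals of a continuous function differ by less than
  any positive \<open>e\<close>.\<close>

lemma Omega_sub_0: "Omega_sub 0 = {exp_measure 0}"
proof -
  have E: "exp_measure 0 \<in> Omega_sub 0" by (rule exp_measure_Omega_sub) simp
  have "m = exp_measure 0" if m: "m \<in> Omega_sub 0" for m
  proof (rule prob_measures_eqI)
    show pm: "m \<in> prob_measures" "exp_measure 0 \<in> prob_measures" using m E Omega_sub_subset by auto
    fix f :: "circle \<Rightarrow> real" assume f: "continuous_on UNIV f"
    have "\<bar>(\<integral>x. f x \<partial>m) - (\<integral>x. f x \<partial>exp_measure 0)\<bar> < e" if e: "0 < e" for e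
    proof -
      obtain N where N: "0 < N" "(\<forall>j\<in>{0..<int N}.
          measure m (circle_arc N j) = measure (exp_measure 0) (circle_arc N j)) \<longrightarrow>
          \<bar>(\<integral>x. f x \<partial>m) - (\<integral>x. f x \<partial>exp_measure 0)\<bar> < e"
        using integral_close_if_measure_arc_eq[OF f e] pm by blast
      then show ?thesis
        by (simp add: Omega_sub_0_measure_arc[OF m] Omega_sub_0_measure_arc[OF E])
    qed
    \<comment> \<open>A nonzero difference would be less than itself in absolute value.\<close>
    from this[of "\<bar>(\<integral>x. f x \<partial>m) - (\<integral>x. f x \<partial>exp_measure 0)\<bar>"]
    show "(\<integral>x. f x \<partial>m) = (\<integral>x. f x \<partial>exp_measure 0)" by auto
  qed
  with E show ?thesis by blast
qed

theorem theorem7p1: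
  fixes r :: real
  assumes "0 \<le> r"
  shows "Omega_sub r = closed_convex_hull {comp_rot (exp_measure r) s | s. 0 \<le> s \<and> s < 1}
    \<and> (r = 0 \<longrightarrow> exp_measure r = lebesgue_circle \<and> Omega_sub r = {lebesgue_circle})"
proof (intro conjI impI)
  let ?K = "{comp_rot (exp_measure r) s | s. 0 \<le> s \<and> s < 1}"
  have K: "?K \<subseteq> Omega_sub r"
    by (auto intro!: comp_rot_Omega_sub exp_measure_Omega_sub assms)
  have hull: "measure_convex_hull ?K \<subseteq> Omega_sub r"
    by (rule measure_convex_hull_Omega_sub[OF K])
  show "Omega_sub r = closed_convex_hull ?K"
  proof
    show "closed_convex_hull ?K \<subseteq> Omega_sub r"
      unfolding closed_convex_hull_def by (rule closure_of_minimal[OF hull closedin_Omega_sub])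
    show "Omega_sub r \<subseteq> closed_convex_hull ?K"
    proof
      fix m assume m: "m \<in> Omega_sub r"
      have "\<exists>m'\<in>measure_convex_hull ?K. \<forall>j\<in>{0..<int N}.
          measure m (circle_arc N j) = measure m' (circle_arc N j)"
        if N: "0 < N" for N
      \<comment> \<open>For \<open>r = 0\<close> the weights of the general construction would
        divide by \<open>q - 1 = 0\<close>. Instead any member of the hull serves, as all measures
        in \<open>Omega_sub 0\<close> agree on the arcs.\<close>
      proof (cases "r = 0")
        case True
        have "comp_rot (exp_measure r) 0 \<in> ?K" by force
        \<comment> \<open>A one-term combination shows that the hull is not empty.\<close>
        then have "measure_convex_hull ?K \<noteq> {}"
          using measure_convex_hull_sumI[of ?K "{()}" "\<lambda>_. comp_rot (exp_measure r) 0" "\<lambda>_. 1"]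
            subset_trans[OF K Omega_sub_subset] by auto
        then obtain m' where "m' \<in> measure_convex_hull ?K" by blast
        with hull True have "m' \<in> Omega_sub 0" by blast
        with m True have "measure m (circle_arc N j) = measure m' (circle_arc N j)"
          if "j \<in> {0..<int N}" for j
          using that by (simp add: Omega_sub_0_measure_arc[OF _ N])
        with \<open>m' \<in> measure_convex_hull ?K\<close> show ?thesis by blast
      next
        case False
        with assms have "0 < r" by simp
        then show ?thesis by (rule ex_convex_combination_arc_eq[OF _ N m])
      qed
      then show "m \<in> closed_convex_hull ?K"
        unfolding closed_convex_hull_def
        using m hull Omega_sub_subset by (intro in_closure_of_weakstarI) blast+
    qed
  qed
  assume "r = 0"
  then show "exp_measure r = lebesgue_circle" "Omega_sub r = {lebesgue_circle}"
    by (simp_all add: Omega_sub_0 exp_measure_0)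
qed

end
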